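(* For a set of patterns $\{\rho_1,\rho_2\}$, let $\mathrm{a}_{n,k}^{\mathrm{asc}}(\rho_1,\rho_2)$ (respectively $\mathrm{a}_{n,k}^{\mathrm{des}}(\rho_1,\rho_2)$) denote the number of permutations of $\{1,\dots,n\}$ that avoid both $\rho_1$ and $\rho_2$ and have exactly $k$ ascents (respectively $k$ descents). Then for all integers $n\ge1$ and $k\ge0$, $$\mathrm{a}_{n,k}^{\mathrm{asc}}(132,213)=\mathrm{a}_{n,k}^{\mathrm{des}}(132,213)=\mathrm{a}_{n,k}^{\mathrm{asc}}(213,231)=\mathrm{a}_{n,k}^{\mathrm{des}}(213,231)=\binom{n-1}{k}.$$
   Context: $\mathcal{S}_n$ is the set of permutations $\pi=\pi_1\cdots\pi_n$ of $\{1,\dots,n\}$. For $\rho\in\mathcal{S}_m$, $\pi\in\mathcal{S}_n$ contains $\rho$ if there are indices $1\le i_1<\cdots<i_m\le n$ such that $\pi_{i_a}<\pi_{i_b}$ if and only if $\rho_a<\rho_b$; otherwise $\pi$ avoids $\rho$. The number of ascents is $\mathrm{asc}(\pi)=|\{i:\pi_i<\pi_{i+1}\}|$ and the number of descents is $\mathrm{des}(\pi)=|\{i:\pi_i>\pi_{i+1}\}|$, where $1\le i\le n-1$. *)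

theory Defs
  imports "HOL-Combinatorics.Multiset_Permutations"
begin

(* A permutation of {1..n} is given by its word [p_1, ..., p_n], a distinct list with
   element set {1..n}. List positions start at 0, so p_i is entry i - 1; the values
   remain 1, ..., n. *)

definition contains :: "nat list \<Rightarrow> nat list \<Rightarrow> bool" where
  "contains p r \<longleftrightarrow>
     (\<exists>i :: nat \<Rightarrow> nat.
        strict_mono_on {..<length r} i \<and>
        (\<forall>a<length r. i a < length p) \<and>
        (\<forall>a<length r. \<forall>b<length r. p ! i a < p ! i b \<longleftrightarrow> r ! a < r ! b))"

definition avoids :: "nat list \<Rightarrow> nat list \<Rightarrow> bool" where
  "avoids p r \<longleftrightarrow> \<not> contains p r"

definition asc :: "nat list \<Rightarrow> nat" where
  "asc p = card {i. Suc i < length p \<and> p ! i < p ! Suc i}"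

definition des :: "nat list \<Rightarrow> nat" where
  "des p = card {i. Suc i < length p \<and> p ! i > p ! Suc i}"

definition a_asc :: "nat \<Rightarrow> nat \<Rightarrow> nat list \<Rightarrow> nat list \<Rightarrow> nat" where
  "a_asc n k r1 r2 =
     card {p \<in> permutations_of_set {1..n}. avoids p r1 \<and> avoids p r2 \<and> asc p = k}"

definition a_des :: "nat \<Rightarrow> nat \<Rightarrow> nat list \<Rightarrow> nat list \<Rightarrow> nat" where
  "a_des n k r1 r2 =
     card {p \<in> permutations_of_set {1..n}. avoids p r1 \<and> avoids p r2 \<and> des p = k}"

end

theory Submission
  imports Defs
begin

text \<open>
  Every permutation of \<open>{1..n+1}\<close> arises uniquely by putting a first letter \<open>x\<close> in front of a
  permutation \<open>q\<close> of \<open>{1..n}\<close> whose letters \<open>\<ge> x\<close> have been raised by one. For both pairs of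
  patterns, a nonempty avoider \<open>q\<close> has exactly two extensions that are again avoiders: the letter
  \<open>n+1\<close>, which creates a descent, and one letter \<open>x \<le> hd q\<close>, which creates an ascent (\<open>x = hd q\<close>
  for 132 and 213, \<open>x = 1\<close> for 213 and 231). This is Pascal's recurrence for the number of avoiders
  with \<open>k\<close> ascents. Descents follow by the symmetry of the binomial coefficients.
\<close>

section \<open>Prepending a letter to a permutation\<close>

text \<open>This is the increasing enumeration of the natural numbers other than \<open>x\<close>.
  Being strictly increasing, it leaves ascents and pattern containment unchanged.\<close>

definition shift :: "nat \<Rightarrow> nat \<Rightarrow> nat" where
  "shift x y = (if y < x then y else Suc y)"

definition prepend :: "nat \<Rightarrow> nat list \<Rightarrow> nat list" where
  "prepend x q = x # map (shift x) q"

lemma shift_less_iff [simp]: "shift x y < shift x z \<longleftrightarrow> y < z"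
  by (auto simp: shift_def)

lemma inj_shift: "inj (shift x)"
  by (auto simp: inj_def shift_def split: if_splits)

lemma shift_image:
  assumes "x \<in> {1..Suc n}"
  shows "shift x ` {1..n} = {1..Suc n} - {x}"
proof
  show "shift x ` {1..n} \<subseteq> {1..Suc n} - {x}"
    by (auto simp: shift_def)
  show "{1..Suc n} - {x} \<subseteq> shift x ` {1..n}"
  proof
    fix y assume y: "y \<in> {1..Suc n} - {x}"
    show "y \<in> shift x ` {1..n}"
    proof (cases "y < x")
      case True
      then show ?thesis using y assms by (intro image_eqI[of _ _ y]) (auto simp: shift_def)
    next
      case False
      then show ?thesis using y assms by (intro image_eqI[of _ _ "y - 1"]) (auto simp: shift_def)
    qed
  qed
qed

lemma prepend_in_permutations:
  assumes "x \<in> {1..Suc n}" "q \<in> permutations_of_set {1..n}"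
  shows "prepend x q \<in> permutations_of_set {1..Suc n}"
  using assms shift_image[OF assms(1)]
  by (auto simp: permutations_of_set_def prepend_def distinct_map
      intro: inj_on_subset[OF inj_shift])

text \<open>Removing the first letter \<open>x\<close> leaves a word over the range of
  \<open>shift x\<close>, which can be pulled back letter by letter. With
  \<open>prepend_eq_iff\<close> this makes the decomposition unique.\<close>

lemma permutation_prependE:
  assumes "p \<in> permutations_of_set {1..Suc n}"
  obtains x q where "x \<in> {1..Suc n}" "q \<in> permutations_of_set {1..n}" "p = prepend x q"
proof -
  have p: "set p = {1..Suc n}" "distinct p"
    using assms by (auto simp: permutations_of_set_def)
  then obtain x r where xr: "p = x # r"
    by (cases p) auto
  have x: "x \<in> {1..Suc n}"
    using p(1) xr by auto
  have r: "set r = shift x ` {1..n}" "distinct r"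
    using p xr unfolding shift_image[OF x] by auto
  then obtain q where q: "r = map (shift x) q"
    by (metis ex_map_conv imageE)
  have "set q = {1..n}"
    using r(1) q inj_image_eq_iff[OF inj_shift] by (metis list.set_map)
  then show thesis
    using that[of x q] x r(2) q xr by (auto simp: permutations_of_set_def prepend_def distinct_map)
qed

lemma prepend_eq_iff [simp]: "prepend x q = prepend y r \<longleftrightarrow> x = y \<and> q = r"
  by (auto simp: prepend_def inj_map_eq_map[OF inj_shift])

lemma permutation_nonempty:
  fixes n :: nat
  assumes "q \<in> permutations_of_set {1..n}" "n \<ge> 1"
  shows "q \<noteq> []"
proof -
  have "1 \<in> set q"
    using assms by (simp add: permutations_of_set_def)
  then show ?thesis
    by auto
qed

lemma hd_in_permutation:
  fixes n :: nat
  assumes "q \<in> permutations_of_set {1..n}" "n \<ge> 1"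
  shows "hd q \<in> {1..n}"
  using hd_in_set[OF permutation_nonempty[OF assms]] assms(1) by (simp add: permutations_of_set_def)

section \<open>Ascents and descents\<close>

lemma asc_map_shift: "asc (map (shift x) q) = asc q"
  unfolding asc_def by (rule arg_cong[where f = card]) (auto simp: Suc_lessD)

lemma asc_Cons: "asc (x # q) = (if q \<noteq> [] \<and> x < hd q then Suc (asc q) else asc q)"
proof -
  let ?S = "{i. Suc i < length q \<and> q ! i < q ! Suc i}"
  \<comment> \<open>Position 0 is an ascent exactly when \<open>x\<close> lies below the head of
    \<open>q\<close>; every other ascent is one of \<open>q\<close> moved one place to the
    right.\<close>
  have "{i. Suc i < length (x # q) \<and> (x # q) ! i < (x # q) ! Suc i}
      = (if q \<noteq> [] \<and> x < hd q then {0} else {}) \<union> Suc ` ?S"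
  proof (rule set_eqI)
    fix i
    show "i \<in> {i. Suc i < length (x # q) \<and> (x # q) ! i < (x # q) ! Suc i}
      \<longleftrightarrow> i \<in> (if q \<noteq> [] \<and> x < hd q then {0} else {}) \<union> Suc ` ?S"
      by (cases i) (auto simp: hd_conv_nth)
  qed
  moreover have "finite ?S"
    by (rule finite_subset[of _ "{..<length q}"]) auto
  ultimately show ?thesis
    by (simp add: asc_def card_image)
qed

text \<open>The comparison is weak because a head equal to \<open>x\<close> is itself raised to
  \<open>Suc x\<close>, so \<open>x = hd q\<close> still produces an ascent.\<close>

lemma asc_prepend:
  assumes "q \<noteq> []"
  shows "asc (prepend x q) = (if x \<le> hd q then Suc (asc q) else asc q)"
  using assms by (auto simp: prepend_def asc_Cons asc_map_shift hd_map shift_def)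

text \<open>Distinct letters admit no ties, so each of the adjacent pairs is an ascent or a descent
  and never both.\<close>

lemma asc_plus_des:
  assumes "distinct p"
  shows "asc p + des p = length p - 1"
proof -
  let ?A = "{i. Suc i < length p \<and> p ! i < p ! Suc i}"
  let ?D = "{i. Suc i < length p \<and> p ! i > p ! Suc i}"
  have fin: "finite ?A" "finite ?D"
    by (rule finite_subset[of _ "{..<length p}"]; auto)+
  have "p ! i < p ! Suc i \<or> p ! i > p ! Suc i" if "Suc i < length p" for i
    using assms that nth_eq_iff_index_eq[of p i "Suc i"] by linarith
  then have "?A \<union> ?D = {i. Suc i < length p}"
    by blast
  also have "\<dots> = {..<length p - 1}"
    by auto
  finally have "?A \<union> ?D = {..<length p - 1}" .
  then have "card (?A \<union> ?D) = length p - 1"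
    by simp
  moreover have "card (?A \<union> ?D) = card ?A + card ?D"
    by (rule card_Un_disjoint) (use fin in auto)
  ultimately show ?thesis
    by (simp add: asc_def des_def)
qed

section \<open>Pascal's recurrence for ascents\<close>

text \<open>An abstract form serving both pairs of patterns: \<open>P\<close> stands for avoidance
  and \<open>lo q\<close> for the small letter that may be prepended. The bound
  \<open>lo q \<le> hd q\<close> forces a new ascent, while \<open>Suc n\<close> exceeds every
  letter of \<open>q\<close> and adds none.\<close>

lemma card_asc_eq_binomial:
  fixes P :: "nat list \<Rightarrow> bool" and lo :: "nat list \<Rightarrow> nat"
  assumes base: "P [1]"
    and lo: "\<And>n q. n \<ge> 1 \<Longrightarrow> q \<in> permutations_of_set {1..n} \<Longrightarrow> lo q \<in> {1..hd q}"
    and step: "\<And>n q x. n \<ge> 1 \<Longrightarrow> q \<in> permutations_of_set {1..n} \<Longrightarrow> x \<in> {1..Suc n} \<Longrightarrow>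
      P (prepend x q) \<longleftrightarrow> P q \<and> (x = lo q \<or> x = Suc n)"
    and "n \<ge> 1"
  shows "card {p \<in> permutations_of_set {1..n}. P p \<and> asc p = k} = (n - 1) choose k"
  using \<open>n \<ge> 1\<close>
proof (induction n arbitrary: k rule: dec_induct)
  case base
  have "{p \<in> permutations_of_set {1..1}. P p \<and> asc p = k} = (if k = 0 then {[1]} else {})"
    using \<open>P [1]\<close> by (auto simp: asc_def)
  then show ?case
    by (cases k) auto
next
  case (step n)
  let ?C = "\<lambda>n k. {p \<in> permutations_of_set {1..n}. P p \<and> asc p = k}"
  \<comment> \<open>Writing \<open>Suc (asc q) = k\<close> instead of subtracting from
    \<open>k\<close> makes this family empty for \<open>k = 0\<close>.\<close>
  let ?L = "(\<lambda>q. prepend (lo q) q) ` {q \<in> permutations_of_set {1..n}. P q \<and> Suc (asc q) = k}"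
  let ?T = "prepend (Suc n) ` ?C n k"
  have hd: "q \<noteq> [] \<and> hd q \<in> {1..n} \<and> lo q \<in> {1..Suc n}" if "q \<in> permutations_of_set {1..n}" for q
  proof -
    have "q \<noteq> []" "hd q \<in> {1..n}"
      using permutation_nonempty hd_in_permutation that step.hyps(1) by blast+
    then show ?thesis
      using lo[OF step.hyps(1) that] by auto
  qed
  have asc_top: "asc (prepend (Suc n) q) = asc q" if "q \<in> permutations_of_set {1..n}" for q
    using hd[OF that] by (auto simp: asc_prepend)
  have asc_lo: "asc (prepend (lo q) q) = Suc (asc q)" if "q \<in> permutations_of_set {1..n}" for q
    using hd[OF that] lo[OF step.hyps(1) that] by (auto simp: asc_prepend)
  note P_prepend = assms(3)[OF step.hyps(1)]
  have "?C (Suc n) k = ?L \<union> ?T"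
  proof
    show "?C (Suc n) k \<subseteq> ?L \<union> ?T"
    proof
      fix p assume p: "p \<in> ?C (Suc n) k"
      then obtain x q where xq: "x \<in> {1..Suc n}" "q \<in> permutations_of_set {1..n}" "p = prepend x q"
        using permutation_prependE by blast
      then have "P q" "x = lo q \<or> x = Suc n"
        using p P_prepend[OF xq(2,1)] by auto
      then show "p \<in> ?L \<union> ?T"
        using p xq asc_top asc_lo by auto
    qed
    show "?L \<union> ?T \<subseteq> ?C (Suc n) k"
      using hd asc_top asc_lo P_prepend prepend_in_permutations by auto
  qed
  \<comment> \<open>Since \<open>lo q \<le> hd q \<le> n\<close>, the two families differ in their
    first letters and are disjoint.\<close>
  moreover have "lo q \<noteq> Suc n" if "q \<in> permutations_of_set {1..n}" for q
    using hd[OF that] lo[OF step.hyps(1) that] by auto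
  then have "?L \<inter> ?T = {}"
    by auto
  ultimately have "card (?C (Suc n) k) = card ?L + card ?T"
    by (simp only: card_Un_disjoint finite_imageI finite_Collect_conjI finite_permutations_of_set
        Collect_mem_eq simp_thms)
  also have "card ?L = card {q \<in> permutations_of_set {1..n}. P q \<and> Suc (asc q) = k}"
    by (intro card_image inj_onI) simp
  also have "card ?T = card (?C n k)"
    by (intro card_image inj_onI) simp
  also have "card (?C n k) = (n - 1) choose k"
    by (rule step.IH)
  also have "card {q \<in> permutations_of_set {1..n}. P q \<and> Suc (asc q) = k} =
      (case k of 0 \<Rightarrow> 0 | Suc j \<Rightarrow> (n - 1) choose j)"
    using step.IH by (cases k) simp_all
  \<comment> \<open>This is Pascal's rule; \<open>n \<ge> 1\<close> ensures that
    \<open>n - 1\<close> is a true predecessor of \<open>n\<close>.\<close>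
  also have "\<dots> + ((n - 1) choose k) = (Suc n - 1) choose k"
    using step.hyps(1) by (cases n; cases k) simp_all
  finally show ?case .
qed

section \<open>From ascents to descents\<close>

text \<open>Ascents and descents of a permutation add up to \<open>n - 1\<close>. The bound on
  \<open>k\<close> keeps the subtraction \<open>n - 1 - k\<close> from being truncated.\<close>

lemma card_des_eq_card_asc:
  assumes "k \<le> n - 1"
  shows "card {p \<in> permutations_of_set {1..n}. P p \<and> des p = k}
    = card {p \<in> permutations_of_set {1..n}. P p \<and> asc p = n - 1 - k}"
proof -
  have "asc p + des p = n - 1" if "p \<in> permutations_of_set {1..n}" for p
    using that asc_plus_des[of p] length_finite_permutations_of_set[of p "{1..n}"]
    by (simp add: permutations_of_set_def)
  then have "des p = k \<longleftrightarrow> asc p = n - 1 - k" if "p \<in> permutations_of_set {1..n}" for p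
    using that assms by fastforce
  then show ?thesis
    by (intro arg_cong[where f = card]) auto
qed

lemma card_des_eq_binomial:
  assumes "\<And>k. card {p \<in> permutations_of_set {1..n}. P p \<and> asc p = k} = (n - 1) choose k"
  shows "card {p \<in> permutations_of_set {1..n}. P p \<and> des p = k} = (n - 1) choose k"
proof (cases "k \<le> n - 1")
  case True
  then show ?thesis
    using assms card_des_eq_card_asc[OF True, of P] binomial_symmetric[OF True] by simp
next
  case False
  \<comment> \<open>A permutation has at most \<open>n - 1\<close> descents, so here both the count
    and the binomial coefficient vanish.\<close>
  have "des p \<noteq> k" if "p \<in> permutations_of_set {1..n}" for p
    using that False asc_plus_des[of p] length_finite_permutations_of_set[of p "{1..n}"]
    by (simp add: permutations_of_set_def)
  then show ?thesis
    using False by (simp add: binomial_eq_0)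
qed

section \<open>Patterns of length three\<close>

text \<open>An increasing map on three indices is the same as three increasing positions. Only the
  last one needs a bound by the length.\<close>

lemma contains_length3_iff:
  "contains p [a, b, c] \<longleftrightarrow>
    (\<exists>i j l. i < j \<and> j < l \<and> l < length p \<and>
      (\<forall>s<3. \<forall>t<3. p ! ([i, j, l] ! s) < p ! ([i, j, l] ! t) \<longleftrightarrow> [a, b, c] ! s < [a, b, c] ! t))"
    (is "?L \<longleftrightarrow> ?R")
proof
  assume ?L
  then obtain f where f: "strict_mono_on {..<3} f" "\<forall>s<3. f s < length p"
    "\<forall>s<3. \<forall>t<3. p ! f s < p ! f t \<longleftrightarrow> [a, b, c] ! s < [a, b, c] ! t"
    by (auto simp: contains_def numeral_3_eq_3)
  have "f 0 < f 1" "f 1 < f 2"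
    using f(1) by (auto simp: strict_mono_on_def)
  moreover have "[f 0, f 1, f 2] ! s = f s" if "s < 3" for s
    using that by (auto simp: less_Suc_eq numeral_3_eq_3 numeral_2_eq_2)
  ultimately show ?R
    using f(2,3) by (intro exI[of _ "f 0"] exI[of _ "f 1"] exI[of _ "f 2"]) simp
next
  assume ?R
  then obtain i j l where ijl: "i < j" "j < l" "l < length p"
    "\<forall>s<3. \<forall>t<3. p ! ([i, j, l] ! s) < p ! ([i, j, l] ! t) \<longleftrightarrow> [a, b, c] ! s < [a, b, c] ! t"
    by blast
  have "strict_mono_on {..<3} ((!) [i, j, l])"
    using ijl(1,2) by (auto simp: strict_mono_on_def less_Suc_eq numeral_3_eq_3)
  moreover have "\<forall>s<3. [i, j, l] ! s < length p"
    using ijl(1-3) by (auto simp: less_Suc_eq numeral_3_eq_3)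
  ultimately show ?L
    using ijl(4) unfolding contains_def
    by (intro exI[of _ "(!) [i, j, l]"]) (simp add: numeral_3_eq_3)
qed

text \<open>Of the nine comparisons only those between letters of consecutive rank matter; the
  others follow by transitivity and asymmetry.\<close>

lemma avoids_132_iff:
  "avoids p [1, 3, 2] \<longleftrightarrow> \<not> (\<exists>i j l. i < j \<and> j < l \<and> l < length p \<and> p ! i < p ! l \<and> p ! l < p ! j)"
proof -
  have "(\<forall>s<3. \<forall>t<3. p ! ([i, j, l] ! s) < p ! ([i, j, l] ! t) \<longleftrightarrow>
      [1, 3, 2 :: nat] ! s < [1, 3, 2] ! t) \<longleftrightarrow> p ! i < p ! l \<and> p ! l < p ! j" for i j l
    by (auto simp: numeral_3_eq_3 numeral_2_eq_2 All_less_Suc2)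
  then show ?thesis
    unfolding avoids_def contains_length3_iff by simp
qed

lemma avoids_213_iff:
  "avoids p [2, 1, 3] \<longleftrightarrow> \<not> (\<exists>i j l. i < j \<and> j < l \<and> l < length p \<and> p ! j < p ! i \<and> p ! i < p ! l)"
proof -
  have "(\<forall>s<3. \<forall>t<3. p ! ([i, j, l] ! s) < p ! ([i, j, l] ! t) \<longleftrightarrow>
      [2, 1, 3 :: nat] ! s < [2, 1, 3] ! t) \<longleftrightarrow> p ! j < p ! i \<and> p ! i < p ! l" for i j l
    by (auto simp: numeral_3_eq_3 numeral_2_eq_2 All_less_Suc2)
  then show ?thesis
    unfolding avoids_def contains_length3_iff by simp
qed

lemma avoids_231_iff:
  "avoids p [2, 3, 1] \<longleftrightarrow> \<not> (\<exists>i j l. i < j \<and> j < l \<and> l < length p \<and> p ! l < p ! i \<and> p ! i < p ! j)"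
proof -
  have "(\<forall>s<3. \<forall>t<3. p ! ([i, j, l] ! s) < p ! ([i, j, l] ! t) \<longleftrightarrow>
      [2, 3, 1 :: nat] ! s < [2, 3, 1] ! t) \<longleftrightarrow> p ! l < p ! i \<and> p ! i < p ! j" for i j l
    by (auto simp: numeral_3_eq_3 numeral_2_eq_2 All_less_Suc2)
  then show ?thesis
    unfolding avoids_def contains_length3_iff by simp
qed

text \<open>Containment depends only on the relative order of letters, which \<open>shift x\<close>
  preserves.\<close>

lemma avoids_map_shift: "avoids (map (shift x) q) r \<longleftrightarrow> avoids q r"
  unfolding avoids_def contains_def by (simp cong: conj_cong)

text \<open>Case split on whether the first of three positions in a nonempty word is its head. Only
  that position can be 0.\<close>

lemma ex_less3_Suc:
  "(\<exists>i j l. i < j \<and> j < l \<and> l < Suc n \<and> Q i j l) \<longleftrightarrow>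
    (\<exists>i j l. i < j \<and> j < l \<and> l < n \<and> Q (Suc i) (Suc j) (Suc l)) \<or>
    (\<exists>j l. j < l \<and> l < n \<and> Q 0 (Suc j) (Suc l))" (is "?L \<longleftrightarrow> ?R")
proof
  assume ?L
  then obtain i j l where "i < j" "j < l" "l < Suc n" "Q i j l"
    by blast
  then show ?R
    by (cases i; cases j; cases l) auto
next
  assume ?R
  then show ?L
    by (elim disjE exE) (metis Suc_mono, metis Suc_mono zero_less_Suc)
qed

text \<open>An occurrence not already in \<open>q\<close> must use \<open>x\<close> as its first
  letter, here in the role of 1; in the next two lemmas \<open>x\<close> plays the 2.\<close>

lemma avoids_132_Cons:
  "avoids (x # q) [1, 3, 2] \<longleftrightarrow> avoids q [1, 3, 2] \<and>
    \<not> (\<exists>j l. j < l \<and> l < length q \<and> x < q ! l \<and> q ! l < q ! j)"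
  unfolding avoids_132_iff list.size(4) add_Suc_right add_0_right ex_less3_Suc by simp

lemma avoids_213_Cons:
  "avoids (x # q) [2, 1, 3] \<longleftrightarrow> avoids q [2, 1, 3] \<and>
    \<not> (\<exists>j l. j < l \<and> l < length q \<and> q ! j < x \<and> x < q ! l)"
  unfolding avoids_213_iff list.size(4) add_Suc_right add_0_right ex_less3_Suc by simp

lemma avoids_231_Cons:
  "avoids (x # q) [2, 3, 1] \<longleftrightarrow> avoids q [2, 3, 1] \<and>
    \<not> (\<exists>j l. j < l \<and> l < length q \<and> q ! l < x \<and> x < q ! j)"
  unfolding avoids_231_iff list.size(4) add_Suc_right add_0_right ex_less3_Suc by simp

section \<open>The patterns 213 and 231\<close>

text \<open>With \<open>x\<close> as the 2, one pattern has the smaller letter before the larger and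
  the other has it after. Together they forbid such letters in either order, so positions drop
  out.\<close>

lemma avoids_213_231_Cons:
  "avoids (x # q) [2, 1, 3] \<and> avoids (x # q) [2, 3, 1] \<longleftrightarrow>
    (avoids q [2, 1, 3] \<and> avoids q [2, 3, 1]) \<and> \<not> (\<exists>y\<in>set q. \<exists>z\<in>set q. y < x \<and> x < z)"
  (is "_ \<longleftrightarrow> _ \<and> \<not> ?E")
proof -
  have "?E \<longleftrightarrow> (\<exists>j<length q. \<exists>l<length q. q ! j < x \<and> x < q ! l)"
    by (metis in_set_conv_nth)
  also have "\<dots> \<longleftrightarrow> (\<exists>j l. j < l \<and> l < length q \<and> q ! j < x \<and> x < q ! l) \<or>
      (\<exists>j l. j < l \<and> l < length q \<and> q ! l < x \<and> x < q ! j)"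
    (is "?D \<longleftrightarrow> ?L \<or> ?R")
  proof
    assume ?D
    then obtain j l where jl: "j < length q" "l < length q" "q ! j < x" "x < q ! l"
      by blast
    then have "j \<noteq> l"
      by auto
    then consider "j < l" | "l < j"
      by linarith
    then show "?L \<or> ?R"
      using jl by cases blast+
  next
    assume "?L \<or> ?R"
    then show ?D
      using less_trans by blast
  qed
  finally show ?thesis
    unfolding avoids_213_Cons avoids_231_Cons by blast
qed

text \<open>The tail contains every letter other than \<open>x\<close>, so \<open>x\<close> avoids
  lying between two of them only if it is the least or the greatest.\<close>

lemma avoids_213_231_prepend:
  assumes "q \<in> permutations_of_set {1..n}" "x \<in> {1..Suc n}"
  shows "avoids (prepend x q) [2, 1, 3] \<and> avoids (prepend x q) [2, 3, 1] \<longleftrightarrow>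
    (avoids q [2, 1, 3] \<and> avoids q [2, 3, 1]) \<and> (x = 1 \<or> x = Suc n)"
proof -
  have "set (map (shift x) q) = {1..Suc n} - {x}"
    using assms shift_image[OF assms(2)] by (simp add: permutations_of_set_def)
  moreover have "(\<exists>y\<in>{1..Suc n} - {x}. \<exists>z\<in>{1..Suc n} - {x}. y < x \<and> x < z) \<longleftrightarrow>
      x \<noteq> 1 \<and> x \<noteq> Suc n"
  proof
    assume "x \<noteq> 1 \<and> x \<noteq> Suc n"
    then show "\<exists>y\<in>{1..Suc n} - {x}. \<exists>z\<in>{1..Suc n} - {x}. y < x \<and> x < z"
      using assms(2) by (intro bexI[of _ 1] bexI[of _ "Suc n"]) auto
  qed auto
  ultimately show ?thesis
    unfolding prepend_def avoids_213_231_Cons avoids_map_shift by simp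
qed

section \<open>The patterns 132 and 213\<close>

text \<open>Unless \<open>x\<close> is the top letter, \<open>Suc x\<close> occurs in the tail, and
  it has to come first there. Conversely, if \<open>Suc x\<close> follows \<open>x\<close>
  immediately, it can replace \<open>x\<close> in any occurrence starting with \<open>x\<close>,
  which gives an occurrence inside the tail.\<close>

lemma avoids_132_213_prepend:
  assumes q: "q \<in> permutations_of_set {1..n}" and x: "x \<in> {1..Suc n}" and "n \<ge> 1"
  shows "avoids (prepend x q) [1, 3, 2] \<and> avoids (prepend x q) [2, 1, 3] \<longleftrightarrow>
    (avoids q [1, 3, 2] \<and> avoids q [2, 1, 3]) \<and> (x = hd q \<or> x = Suc n)"
proof -
  define r where "r = map (shift x) q"
  have setr: "set r = {1..Suc n} - {x}"
    using q shift_image[OF x] by (simp add: permutations_of_set_def r_def)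
  have "distinct r"
    using prepend_in_permutations[OF x q] by (auto simp: permutations_of_set_def prepend_def r_def)
  have "q \<noteq> []"
    using permutation_nonempty q \<open>n \<ge> 1\<close> by blast
  then have r0: "r ! 0 = shift x (hd q)" and "r \<noteq> []"
    by (auto simp: r_def hd_conv_nth)
  have r0_neq: "r ! l \<noteq> r ! 0" if "l < length r" "l \<noteq> 0" for l
    using that \<open>distinct r\<close> \<open>r \<noteq> []\<close> by (simp add: nth_eq_iff_index_eq)
  have "(\<not> (\<exists>j l. j < l \<and> l < length r \<and> x < r ! l \<and> r ! l < r ! j) \<and>
        \<not> (\<exists>j l. j < l \<and> l < length r \<and> r ! j < x \<and> x < r ! l)) \<longleftrightarrow> (x = hd q \<or> x = Suc n)"
    (is "?N132 \<and> ?N213 \<longleftrightarrow> _")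
    if av: "avoids r [1, 3, 2]" "avoids r [2, 1, 3]"
  proof
    assume N: "?N132 \<and> ?N213"
    show "x = hd q \<or> x = Suc n"
    proof (rule ccontr)
      assume neg: "\<not> (x = hd q \<or> x = Suc n)"
      \<comment> \<open>The letter just above \<open>x\<close> exists because
        \<open>x \<noteq> Suc n\<close>; it is the letter that completes a forbidden
        pattern.\<close>
      then have "Suc x \<in> set r"
        using x setr by auto
      then obtain l where l: "l < length r" "r ! l = Suc x"
        by (metis in_set_conv_nth)
      have "r ! 0 \<noteq> Suc x" "r ! 0 \<noteq> x"
        using neg r0 by (auto simp: shift_def split: if_splits)
      moreover from this l have "l > 0"
        using gr0I by fastforce
      \<comment> \<open>If \<open>r ! 0 < x\<close>, then \<open>x\<close>, \<open>r ! 0\<close>,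
        \<open>Suc x\<close> form a 213. Otherwise \<open>r ! 0 > Suc x\<close>, and the same three
        letters form a 132.\<close>
      ultimately show False
        using N l by (metis lessI not_less_eq linorder_neqE_nat)
    qed
  next
    assume "x = hd q \<or> x = Suc n"
    then show "?N132 \<and> ?N213"
    proof
      assume "x = Suc n"
      \<comment> \<open>Either pattern starting with \<open>x\<close> needs a later letter above
        \<open>x\<close>.\<close>
      then have "r ! l < x" if "l < length r" for l
        using setr nth_mem[OF that] by auto
      then show ?thesis
        using less_asym by blast
    next
      assume "x = hd q"
      then have r0: "r ! 0 = Suc x"
        using r0 by (simp add: shift_def)
      have r0_less: "r ! 0 < r ! l" if "x < r ! l" "l < length r" "l \<noteq> 0" for l
        using that r0 r0_neq[of l] by linarith
      \<comment> \<open>Replacing \<open>x\<close> by \<open>r ! 0\<close> yields a 132 at positions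
        0, \<open>j\<close>, \<open>l\<close> of \<open>r\<close>. Position \<open>j\<close> is not
        0, as \<open>r ! j\<close> exceeds \<open>r ! l\<close>, which exceeds
        \<open>r ! 0\<close>.\<close>
      have False if "j < l" "l < length r" "x < r ! l" "r ! l < r ! j" for j l
      proof -
        have "r ! 0 < r ! l"
          using that r0_less by auto
        then have "j \<noteq> 0"
          using that by (cases j) auto
        then show False
          using av(1) that \<open>r ! 0 < r ! l\<close> unfolding avoids_132_iff by blast
      qed
      \<comment> \<open>The same replacement yields a 213 in \<open>r\<close>; here \<open>j\<close>
        is not 0 because \<open>r ! j < x < r ! 0\<close>.\<close>
      moreover have False if "j < l" "l < length r" "r ! j < x" "x < r ! l" for j l
      proof -
        have "j \<noteq> 0"
          using that r0 by (cases j) auto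
        moreover have "r ! j < r ! 0" "r ! 0 < r ! l"
          using that r0 r0_less by auto
        ultimately show False
          using av(2) that unfolding avoids_213_iff by blast
      qed
      ultimately show ?thesis
        by blast
    qed
  qed
  then show ?thesis
    unfolding prepend_def avoids_132_Cons avoids_213_Cons
    unfolding r_def avoids_map_shift by blast
qed

section \<open>The four counts\<close>

lemma card_asc_132_213:
  assumes "n \<ge> 1"
  shows "card {p \<in> permutations_of_set {1..n}.
    (avoids p [1, 3, 2] \<and> avoids p [2, 1, 3]) \<and> asc p = k} = (n - 1) choose k"
proof (rule card_asc_eq_binomial[where lo = hd])
  show "avoids [1] [1, 3, 2] \<and> avoids [1] [2, 1, 3]"
    unfolding avoids_132_iff avoids_213_iff by simp
  show "hd q \<in> {1..hd q}" if "n \<ge> 1" "q \<in> permutations_of_set {1..n}" for n :: nat and q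
    using hd_in_permutation[OF that(2,1)] by simp
qed (use assms avoids_132_213_prepend in blast)+

lemma card_asc_213_231:
  assumes "n \<ge> 1"
  shows "card {p \<in> permutations_of_set {1..n}.
    (avoids p [2, 1, 3] \<and> avoids p [2, 3, 1]) \<and> asc p = k} = (n - 1) choose k"
proof (rule card_asc_eq_binomial[where lo = "\<lambda>_. 1"])
  show "avoids [1] [2, 1, 3] \<and> avoids [1] [2, 3, 1]"
    unfolding avoids_213_iff avoids_231_iff by simp
  show "1 \<in> {1..hd q}" if "n \<ge> 1" "q \<in> permutations_of_set {1..n}" for n :: nat and q
    using hd_in_permutation[OF that(2,1)] by simp
qed (use assms avoids_213_231_prepend in blast)+

theorem proposition10:
  fixes n k :: nat
  assumes "n \<ge> 1"
  shows "a_asc n k [1, 3, 2] [2, 1, 3] = (n - 1) choose k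
    \<and> a_des n k [1, 3, 2] [2, 1, 3] = (n - 1) choose k
    \<and> a_asc n k [2, 1, 3] [2, 3, 1] = (n - 1) choose k
    \<and> a_des n k [2, 1, 3] [2, 3, 1] = (n - 1) choose k"
  using card_asc_132_213[OF assms, of k] card_asc_213_231[OF assms, of k]
    card_des_eq_binomial[OF card_asc_132_213[OF assms], of k]
    card_des_eq_binomial[OF card_asc_213_231[OF assms], of k]
  by (simp add: a_asc_def a_des_def)

end
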